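(* For any Banach space $(X,\|\cdot\|)$, the following statements are equivalent: (i) for every $x^*\in X^*$, the function $\tfrac12\|\cdot\|^2-x^*$ attains a strong minimum over $X$; (ii) $X$ is an E-space.
   Context: $X$ is a (real) Banach space with topological dual $X^*$. A function $I:X\to\mathbb{R}$ attains a strong minimum over $X$ if it has a minimum point $\bar x\in X$ and every sequence $(x_n)$ with $I(x_n)\to\inf_X I$ converges in norm to $\bar x$. A Banach space $X$ is an E-space if $X$ is rotund (strictly convex norm) and every (nonempty) weakly closed set in $X$ is approximately compact. A nonempty set $S\subset X$ is approximately compact if for every $x\in X$, every sequence $(s_n)$ in $S$ with $\|x-s_n\|\to\inf_{s\in S}\|x-s\|$ has a subsequence converging in norm to a point of $S$. *)

theory Defs
  imports "HOL-Analysis.Analysis"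
begin

definition attains_strong_minimum :: "('a::real_normed_vector \<Rightarrow> real) \<Rightarrow> bool" where
  "attains_strong_minimum I \<longleftrightarrow>
     (\<exists>xbar. (\<forall>x. I xbar \<le> I x) \<and>
        (\<forall>s :: nat \<Rightarrow> 'a. (\<lambda>n. I (s n)) \<longlonglongrightarrow> (INF x. I x) \<longrightarrow> s \<longlonglongrightarrow> xbar))"

text \<open>The space is the whole carrier of a type, so its properties are predicates on
  \<open>'a itself\<close>.\<close>

definition rotund :: "'a::real_normed_vector itself \<Rightarrow> bool" where
  "rotund _ \<longleftrightarrow>
     (\<forall>x y :: 'a. norm x = 1 \<and> norm y = 1 \<and> x \<noteq> y \<longrightarrow> norm (midpoint x y) < 1)"

text \<open>The coarsest topology making every continuous linear functional continuous.\<close>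

definition weak_topology :: "'a::real_normed_vector topology" where
  "weak_topology =
     topology_generated_by {blinfun_apply f -` U | (f :: 'a \<Rightarrow>\<^sub>L real) U. open U}"

definition approximately_compact :: "'a::real_normed_vector set \<Rightarrow> bool" where
  "approximately_compact S \<longleftrightarrow>
     (\<forall>x. \<forall>s :: nat \<Rightarrow> 'a.
        (\<forall>n. s n \<in> S) \<and> (\<lambda>n. norm (x - s n)) \<longlonglongrightarrow> (INF y\<in>S. norm (x - y)) \<longrightarrow>
        (\<exists>l\<in>S. \<exists>r :: nat \<Rightarrow> nat. strict_mono r \<and> (s \<circ> r) \<longlonglongrightarrow> l))"

definition E_space :: "'a::banach itself \<Rightarrow> bool" where
  "E_space _ \<longleftrightarrow> rotund TYPE('a) \<and>
     (\<forall>S :: 'a set. S \<noteq> {} \<and> closedin weak_topology S \<longrightarrow> approximately_compact S)"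

end

theory Submission
  imports Defs
begin

text \<open>Write \<open>tilted f x = \<parallel>x\<parallel>\<^sup>2 / 2 - f x\<close>.

From strong minima to an E-space. Rotundity is the uniqueness of the minimizer: if the midpoint of two
unit vectors had norm 1, a functional that norms the midpoint would be tilted to two minimizers.
For approximate compactness, let \<open>s n\<close> in a weakly closed set minimize the distance \<open>d\<close> to \<open>x\<close>.
Suppose that \<open>s n\<close> converges weakly, along some filter, to a point \<open>v\<close>. Then \<open>v\<close> is in the set, so
\<open>\<parallel>v - x\<parallel> \<ge> d\<close>, and weak lower semicontinuity of the norm gives equality. If \<open>f\<close> norms \<open>v - x\<close>, then
\<open>v - x\<close> minimizes \<open>tilted (d f)\<close> and the values at \<open>s n - x\<close> tend to the minimum, so the minimum
being strong forces norm convergence of a subsequence.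

The weak limit exists because the assumption implies reflexivity, in the form of
\<open>strong_minima_imp_weak_limit\<close>. Tychonoff's theorem provides a functional \<open>\<phi>\<close> on the
dual space that is a pointwise limit of evaluations at the \<open>s n\<close>; it has to be an evaluation itself.
The conjugate \<open>c f = max (\<lambda>x. f x - \<parallel>x\<parallel>\<^sup>2 / 2)\<close> is differentiable in every direction, with
derivative the evaluation at the minimizer of \<open>tilted f\<close>: this is what strong minima say in terms of
the dual space. Ekeland's principle for \<open>c - \<phi>\<close> gives functionals where this derivative is
within any \<open>e > 0\<close> of \<open>\<phi>\<close>. So \<open>\<phi>\<close> is a norm limit of evaluations at points of the space, and these
points converge by completeness. This argument avoids James' theorem.

From an E-space to strong minima. The infimum of \<open>tilted f\<close> is \<open>- \<parallel>f\<parallel>\<^sup>2 / 2\<close>, and along a minimizing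
sequence \<open>\<parallel>s n\<parallel> \<longrightarrow> \<parallel>f\<parallel>\<close> and \<open>f (s n) \<longrightarrow> \<parallel>f\<parallel>\<^sup>2\<close>. Rescaled onto the hyperplane \<open>f = \<parallel>f\<parallel>\<^sup>2\<close>, the
sequence minimizes the distance of that weakly closed set to the origin, so a subsequence converges
(\<open>E_space_minimizing_subsequence\<close>). Rotundity leaves only one possible limit.\<close>

section \<open>Linear functionals below sublinear functionals\<close>

definition sublinear :: "('a::real_vector \<Rightarrow> real) \<Rightarrow> bool" where
  "sublinear p \<longleftrightarrow>
     (\<forall>x y. p (x + y) \<le> p x + p y) \<and> (\<forall>t x. 0 < t \<longrightarrow> p (t *\<^sub>R x) = t * p x)"

lemma sublinear_subadd: "sublinear p \<Longrightarrow> p (x + y) \<le> p x + p y"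
  and sublinear_scale: "sublinear p \<Longrightarrow> 0 < t \<Longrightarrow> p (t *\<^sub>R x) = t * p x"
  by (auto simp: sublinear_def)

lemma sublinearI:
  assumes add: "\<And>x y. p (x + y) \<le> p x + p y"
    and scale: "\<And>t x. 0 < t \<Longrightarrow> p (t *\<^sub>R x) \<le> t * p x"
  shows "sublinear p"
  unfolding sublinear_def
proof (intro conjI allI impI add)
  fix t :: real and x assume "0 < t"
  have "p x \<le> (1 / t) * p (t *\<^sub>R x)"
    using scale[of "1 / t" "t *\<^sub>R x"] \<open>0 < t\<close> by simp
  then have "t * p x \<le> p (t *\<^sub>R x)"
    using \<open>0 < t\<close> by (simp add: field_simps)
  then show "p (t *\<^sub>R x) = t * p x"
    using scale[OF \<open>0 < t\<close>, of x] by simp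
qed

lemma sublinear_zero: "sublinear p \<Longrightarrow> p 0 = 0"
  using sublinear_scale[of p 2 0] by simp

lemma sublinear_ge_neg: "sublinear p \<Longrightarrow> - p (- x) \<le> p x"
  using sublinear_subadd[of p x "- x"] sublinear_zero[of p] by simp

lemma sublinear_norm: "sublinear (norm :: 'a::real_normed_vector \<Rightarrow> real)"
  by (rule sublinearI) (auto intro: norm_triangle_ineq)

text \<open>The largest sublinear functional below \<open>p\<close> whose value at \<open>- y\<close> is at most \<open>- p y\<close>.
It serves twice: a minimal \<open>p\<close> coincides with it, which forces additivity, and for the norm it
is the right upper bound for a functional that norms \<open>y\<close>.\<close>

definition lowered :: "('a::real_vector \<Rightarrow> real) \<Rightarrow> 'a \<Rightarrow> 'a \<Rightarrow> real" where
  "lowered p y x = (INF t\<in>{0..}. p (x + t *\<^sub>R y) - t * p y)"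

context
  fixes p :: "'a::real_vector \<Rightarrow> real"
  assumes p: "sublinear p"
begin

lemma lowered_le:
  assumes "0 \<le> t"
  shows "lowered p y x \<le> p (x + t *\<^sub>R y) - t * p y"
  unfolding lowered_def
proof (rule cINF_lower)
  have "- p (- x) \<le> p (x + t *\<^sub>R y) - t * p y" if "0 \<le> t" for t
  proof (cases "t = 0")
    case True
    then show ?thesis using sublinear_ge_neg[OF p, of x] by simp
  next
    case False
    then have "t * p y = p (t *\<^sub>R y)"
      using that sublinear_scale[OF p, of t y] by simp
    then show ?thesis
      using sublinear_subadd[OF p, of "x + t *\<^sub>R y" "- x"] by simp
  qed
  then show "bdd_below ((\<lambda>t. p (x + t *\<^sub>R y) - t * p y) ` {0..})"
    by (intro bdd_belowI2[where m = "- p (- x)"]) auto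
qed (use assms in auto)

lemma lowered_le_self: "lowered p y x \<le> p x"
  using lowered_le[of 0 y x] by simp

lemma lowered_neg: "lowered p y (- y) \<le> - p y"
  using lowered_le[of 1 y "- y"] sublinear_zero[OF p] by simp

lemma sublinear_lowered: "sublinear (lowered p y)"
proof (rule sublinearI)
  fix x x'
  have "lowered p y (x + x') - (p (x' + t *\<^sub>R y) - t * p y) \<le> p (x + s *\<^sub>R y) - s * p y"
    if "0 \<le> s" "0 \<le> t" for s t
    using lowered_le[of "s + t" y "x + x'"] that
      sublinear_subadd[OF p, of "x + s *\<^sub>R y" "x' + t *\<^sub>R y"]
    by (simp add: algebra_simps)
  then have "lowered p y (x + x') - (p (x' + t *\<^sub>R y) - t * p y) \<le> lowered p y x"
    if "0 \<le> t" for t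
    unfolding lowered_def[of p y x] using that by (intro cINF_greatest) auto
  then have "lowered p y (x + x') - lowered p y x \<le> p (x' + t *\<^sub>R y) - t * p y"
    if "0 \<le> t" for t
    using that by (simp add: algebra_simps)
  then have "lowered p y (x + x') - lowered p y x \<le> lowered p y x'"
    unfolding lowered_def[of p y x'] by (intro cINF_greatest) auto
  then show "lowered p y (x + x') \<le> lowered p y x + lowered p y x'"
    by simp
next
  fix r :: real and x assume r: "0 < r"
  have "lowered p y (r *\<^sub>R x) / r \<le> p (x + t *\<^sub>R y) - t * p y" if "0 \<le> t" for t
    using lowered_le[of "r * t" y "r *\<^sub>R x"] that r sublinear_scale[OF p r, of "x + t *\<^sub>R y"]
    by (simp add: field_simps scaleR_add_right)
  then have "lowered p y (r *\<^sub>R x) / r \<le> lowered p y x"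
    unfolding lowered_def[of p y x] by (intro cINF_greatest) auto
  then show "lowered p y (r *\<^sub>R x) \<le> r * lowered p y x"
    using r by (simp add: field_simps)
qed

end

text \<open>By minimality \<open>lowered p y = p\<close>, so \<open>p x \<le> p (x + y) - p y\<close>: this is the reverse of subadditivity.\<close>

lemma minimal_sublinear_linear:
  assumes p: "sublinear p"
    and minimal: "\<And>p'. sublinear p' \<Longrightarrow> p' \<le> p \<Longrightarrow> p' = p"
  shows "linear p"
proof (rule linearI)
  have add: "p (x + y) = p x + p y" for x y
  proof -
    have "lowered p y = p"
      by (intro minimal sublinear_lowered p le_funI lowered_le_self)
    then have "p x \<le> p (x + y) - p y"
      using lowered_le[OF p, of 1 y x] by simp
    then show ?thesis
      using sublinear_subadd[OF p, of x y] by simp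
  qed
  then show "p (x + y) = p x + p y" for x y .
  have neg: "p (- x) = - p x" for x
    using add[of x "- x"] sublinear_zero[OF p] by simp
  show "p (t *\<^sub>R x) = t *\<^sub>R p x" for t x
  proof (cases t "0::real" rule: linorder_cases)
    case less
    then show ?thesis
      using sublinear_scale[OF p, of "- t" x] neg[of "t *\<^sub>R x"] by simp
  qed (simp_all add: sublinear_zero[OF p] sublinear_scale[OF p])
qed

text \<open>A form of the Hahn--Banach theorem that needs no extension from subspaces. The sublinear functionals below
\<open>q\<close> are all bounded below at \<open>x\<close> by \<open>- q (- x)\<close>, so a nonempty chain has its pointwise
infimum as a lower bound, Zorn's lemma gives a minimal one, and minimal ones are linear.\<close>

lemma sublinear_above_linear:
  fixes q :: "'a::real_vector \<Rightarrow> real"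
  assumes q: "sublinear q"
  shows "\<exists>f. linear f \<and> f \<le> q"
proof -
  define A where "A = {p. sublinear p \<and> p \<le> q}"
  have "\<exists>m\<in>A. \<forall>a\<in>A. a \<le> m \<longrightarrow> a = m"
  proof (rule predicate_Zorn)
    show "partial_order_on A (relation_of (\<lambda>a b. b \<le> a) A)"
      by (rule partial_order_on_relation_ofI) auto
  next
    fix C assume C: "C \<in> Chains (relation_of (\<lambda>a b. b \<le> a) A)"
    then have sub: "C \<subseteq> A" and cmp: "\<And>a b. a \<in> C \<Longrightarrow> b \<in> C \<Longrightarrow> a \<le> b \<or> b \<le> a"
      by (auto simp: Chains_def relation_of_def)
    show "\<exists>u\<in>A. \<forall>a\<in>C. u \<le> a"
    proof (cases "C = {}")
      case True
      then show ?thesis using q by (auto simp: A_def)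
    next
      case False
      define u where "u = (\<lambda>x. INF p\<in>C. p x)"
      have subl: "sublinear p" if "p \<in> C" for p
        using that sub by (auto simp: A_def)
      have "- q (- x) \<le> p x" if "p \<in> C" for p x
        using that sub sublinear_ge_neg[OF subl[OF that], of x]
        by (fastforce simp: A_def le_fun_def dest: spec[of _ "- x"])
      then have "bdd_below ((\<lambda>p. p x) ` C)" for x
        by (intro bdd_belowI2[where m = "- q (- x)"]) auto
      then have u_le: "u x \<le> p x" if "p \<in> C" for p x
        unfolding u_def using that by (intro cINF_lower)
      have u_ge: "c \<le> u x" if "\<And>p. p \<in> C \<Longrightarrow> c \<le> p x" for c x
        unfolding u_def using that False by (intro cINF_greatest)
      have "sublinear u"
      proof (rule sublinearI)
        fix x y
        have "u (x + y) \<le> p x + p' y" if "p \<in> C" "p' \<in> C" for p p'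
        proof -
          \<comment> \<open>The smaller of the two serves at both points, and it is subadditive itself.\<close>
          have "\<exists>r\<in>C. r \<le> p \<and> r \<le> p'"
            using cmp[OF that] that by auto
          then obtain r where "r \<in> C" "r x \<le> p x" "r y \<le> p' y"
            by (auto simp: le_fun_def)
          then show ?thesis
            using u_le[of r "x + y"] sublinear_subadd[OF subl, of r x y] by simp
        qed
        then have "u (x + y) - p' y \<le> u x" if "p' \<in> C" for p'
          using that by (intro u_ge) (simp add: algebra_simps)
        then have "u (x + y) - u x \<le> u y"
          by (intro u_ge) (simp add: algebra_simps)
        then show "u (x + y) \<le> u x + u y" by simp
      next
        fix t :: real and x assume t: "0 < t"
        have "u (t *\<^sub>R x) / t \<le> u x"
        proof (rule u_ge)
          fix p assume "p \<in> C"
          then show "u (t *\<^sub>R x) / t \<le> p x"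
            using u_le[of p "t *\<^sub>R x"] sublinear_scale[OF subl t, of p x] t
            by (simp add: field_simps)
        qed
        then show "u (t *\<^sub>R x) \<le> t * u x"
          using t by (simp add: field_simps)
      qed
      moreover obtain p where "p \<in> C" "p \<le> q"
        using False sub by (auto simp: A_def)
      then have "u \<le> q"
        by (meson le_funI order_trans u_le le_funD)
      ultimately show ?thesis
        using u_le by (auto simp: A_def le_fun_def)
    qed
  qed
  then obtain m where "m \<in> A" and "\<And>a. a \<in> A \<Longrightarrow> a \<le> m \<Longrightarrow> a = m"
    by auto
  then show ?thesis
    by (intro exI[of _ m] conjI minimal_sublinear_linear) (auto simp: A_def)
qed

text \<open>A linear functional below \<open>lowered norm u\<close> is below the norm and at most \<open>- \<parallel>u\<parallel>\<close> at \<open>- u\<close>.\<close>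

lemma norming_functional:
  fixes u :: "'a::real_normed_vector"
  obtains f :: "'a \<Rightarrow>\<^sub>L real" where "\<And>x. \<bar>f x\<bar> \<le> norm x" and "f u = norm u"
proof -
  obtain f where f: "linear f" and le: "f \<le> lowered norm u"
    using sublinear_above_linear[OF sublinear_lowered[OF sublinear_norm]] by blast
  have f_le: "f x \<le> norm x" for x
    using le lowered_le_self[OF sublinear_norm, of u x] by (meson le_funD order_trans)
  have abs: "\<bar>f x\<bar> \<le> norm x" for x
    using f_le[of x] f_le[of "- x"] linear_neg[OF f, of x] by simp
  have "f (- u) \<le> - norm u"
    using le lowered_neg[OF sublinear_norm, of u] by (meson le_funD order_trans)
  then have "f u = norm u"
    using f_le[of u] linear_neg[OF f, of u] by simp
  moreover have "bounded_linear f"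
    using f abs by (intro bounded_linear_intro[where K = 1])
      (auto simp: linear_add linear_scale)
  ultimately show ?thesis
    using that[of "Blinfun f"] abs by (simp add: bounded_linear_Blinfun_apply)
qed

section \<open>Ekeland's variational principle\<close>

text \<open>The relation \<open>h y + e * dist x y \<le> h x\<close> is transitive. Moving each time to a point that almost
minimizes \<open>h\<close> among the points related to the current one, the decrease of \<open>h\<close> pays for the distances,
so the points converge; nothing but the limit itself can be related to the limit.\<close>

lemma ekeland:
  fixes h :: "'a::complete_space \<Rightarrow> real"
  assumes e: "0 < e"
    and bounded: "\<And>x. m \<le> h x"
    and lsc: "\<And>x b. b < h x \<Longrightarrow> eventually (\<lambda>y. b < h y) (nhds x)"
  shows "\<exists>x. \<forall>y. y \<noteq> x \<longrightarrow> h x < h y + e * dist x y"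
proof -
  define S where "S x = {y. h y + e * dist x y \<le> h x}" for x
  have refl: "x \<in> S x" for x
    by (simp add: S_def)
  have trans: "z \<in> S x" if "y \<in> S x" "z \<in> S y" for x y z
  proof -
    have "e * dist x z \<le> e * dist x y + e * dist y z"
      using e dist_triangle[of x z y] by (simp flip: distrib_left)
    then show ?thesis using that by (simp add: S_def)
  qed
  have "\<exists>y\<in>S x. \<forall>z\<in>S x. h y \<le> h z + inverse (real (Suc n))" for n x
  proof -
    have bdd: "bdd_below (h ` S x)"
      using bounded by (intro bdd_belowI2)
    have "Inf (h ` S x) < Inf (h ` S x) + inverse (real (Suc n))" by simp
    then obtain y where y: "y \<in> S x" "h y < Inf (h ` S x) + inverse (real (Suc n))"
      using cInf_lessD[of "h ` S x"] refl[of x] by blast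
    then have "h y \<le> h z + inverse (real (Suc n))" if "z \<in> S x" for z
      using cINF_lower[OF bdd that] by linarith
    with y show ?thesis by blast
  qed
  then have "\<forall>n x. \<exists>y. y \<in> S x \<and> (\<forall>z\<in>S x. h y \<le> h z + inverse (real (Suc n)))"
    by blast
  then obtain T where "\<forall>n x. T n x \<in> S x \<and> (\<forall>z\<in>S x. h (T n x) \<le> h z + inverse (real (Suc n)))"
    unfolding choice_iff by blast
  then have T: "\<And>n x. T n x \<in> S x"
    and Tmin: "\<And>n x z. z \<in> S x \<Longrightarrow> h (T n x) \<le> h z + inverse (real (Suc n))"
    by blast+
  \<comment> \<open>The starting point is arbitrary.\<close>
  define X where "X = rec_nat undefined T"
  have X_Suc: "X (Suc n) = T n (X n)" for n
    by (simp add: X_def)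
  have nested: "X k \<in> S (X n)" if "n \<le> k" for n k
    using that by (induction rule: dec_induct) (auto intro: refl trans T simp: X_Suc)
  then have dist_le: "e * dist (X n) (X k) \<le> h (X n) - h (X k)" if "n \<le> k" for n k
    using that by (force simp: S_def)
  have "decseq (\<lambda>n. h (X n))"
    unfolding decseq_def using dist_le e by (smt (verit) zero_le_dist mult_nonneg_nonneg)
  then obtain L where "(\<lambda>n. h (X n)) \<longlonglongrightarrow> L"
    using decseq_convergent[of "\<lambda>n. h (X n)" m] bounded by blast
  then have "Cauchy (\<lambda>n. h (X n))"
    by (rule LIMSEQ_imp_Cauchy)
  have "Cauchy X"
  proof (rule metric_CauchyI)
    fix d :: real assume "0 < d"
    then obtain N where N: "\<And>m n. N \<le> m \<Longrightarrow> N \<le> n \<Longrightarrow> dist (h (X m)) (h (X n)) < e * d"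
      using metric_CauchyD[OF \<open>Cauchy (\<lambda>n. h (X n))\<close>, of "e * d"] e by auto
    have *: "dist (X m) (X n) < d" if "N \<le> m" "m \<le> n" for m n
    proof -
      have "e * dist (X m) (X n) < e * d"
        using dist_le[of m n] N[of m n] that by (simp add: dist_real_def)
      then show ?thesis using e by simp
    qed
    show "\<exists>N. \<forall>m\<ge>N. \<forall>n\<ge>N. dist (X m) (X n) < d"
      using * by (intro exI[of _ N]) (metis dist_commute linear)
  qed
  then obtain x where x: "X \<longlonglongrightarrow> x"
    using Cauchy_convergent convergent_def by blast
  have xS: "x \<in> S (X n)" for n
  proof -
    have "h x \<le> h (X n) - e * dist (X n) x"
    proof (rule dense_le)
      fix b assume "b < h x"
      then have "eventually (\<lambda>k. b < h (X k)) sequentially"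
        using lsc x by (auto simp: filterlim_iff)
      then have "eventually (\<lambda>k. b \<le> h (X n) - e * dist (X n) (X k)) sequentially"
        using eventually_ge_at_top[of n]
        by eventually_elim (use dist_le[of n] in force)
      moreover have "(\<lambda>k. h (X n) - e * dist (X n) (X k)) \<longlonglongrightarrow> h (X n) - e * dist (X n) x"
        by (intro tendsto_intros x)
      ultimately show "b \<le> h (X n) - e * dist (X n) x"
        by (intro tendsto_lowerbound) auto
    qed
    then show ?thesis by (simp add: S_def)
  qed
  have "h x < h y + e * dist x y" if "y \<noteq> x" for y
  proof (rule ccontr)
    assume "\<not> ?thesis"
    then have y: "y \<in> S x" by (simp add: S_def)
    have "h x \<le> h y + inverse (real (Suc n))" for n
    proof -
      have "h x \<le> h (X (Suc n))"
        using xS[of "Suc n"] e unfolding S_def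
        by (smt (verit) mem_Collect_eq mult_nonneg_nonneg zero_le_dist)
      also have "\<dots> \<le> h y + inverse (real (Suc n))"
        unfolding X_Suc using trans[OF xS y] by (rule Tmin)
      finally show ?thesis .
    qed
    moreover have "(\<lambda>n. h y + inverse (real (Suc n))) \<longlonglongrightarrow> h y + 0"
      by (intro tendsto_intros LIMSEQ_inverse_real_of_nat)
    ultimately have "h x \<le> h y"
      using LIMSEQ_le_const by fastforce
    then have "e * dist x y \<le> 0"
      using y by (simp add: S_def)
    then show False
      using e that by (simp add: mult_le_0_iff)
  qed
  then show ?thesis by blast
qed

section \<open>Strong minima of tilted half squared norms\<close>

abbreviation tilted :: "('a::real_normed_vector \<Rightarrow>\<^sub>L real) \<Rightarrow> 'a \<Rightarrow> real" where
  "tilted f x \<equiv> 1 / 2 * (norm x)\<^sup>2 - blinfun_apply f x"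

lemma strong_minimumE:
  assumes "attains_strong_minimum I"
  obtains x where "\<And>y. I x \<le> I y" and "\<And>s. (\<lambda>n. I (s n)) \<longlonglongrightarrow> I x \<Longrightarrow> s \<longlonglongrightarrow> x"
proof -
  obtain x where min: "\<And>y. I x \<le> I y"
    and conv: "\<And>s. (\<lambda>n. I (s n)) \<longlonglongrightarrow> (INF y. I y) \<Longrightarrow> s \<longlonglongrightarrow> x"
    using assms by (auto simp: attains_strong_minimum_def)
  have "(INF y. I y) = I x"
    by (rule cInf_eq_minimum) (auto intro: min)
  then show ?thesis
    using that[of x] min conv by simp
qed

text \<open>The constant sequence at any minimizer is minimizing, so a strong minimum has only one minimizer.\<close>

lemma strong_minimum_at_minimizer:
  assumes "attains_strong_minimum I" and z: "\<And>y. I z \<le> I y"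
    and s: "(\<lambda>n. I (s n)) \<longlonglongrightarrow> I z"
  shows "s \<longlonglongrightarrow> z"
proof -
  obtain x where x: "\<And>y. I x \<le> I y" and conv: "\<And>s. (\<lambda>n. I (s n)) \<longlonglongrightarrow> I x \<Longrightarrow> s \<longlonglongrightarrow> x"
    using strong_minimumE[OF assms(1)] by blast
  have "I z = I x"
    using x z by (meson order_antisym)
  then have "(\<lambda>n::nat. z) \<longlonglongrightarrow> x"
    by (intro conv) simp
  then have "z = x"
    using LIMSEQ_unique tendsto_const by blast
  then show ?thesis
    using conv s \<open>I z = I x\<close> by simp
qed

section \<open>Weak limits\<close>

text \<open>The evaluations at the points \<open>u n\<close> stay in a product of compact intervals, which is compact by
Tychonoff's theorem. A filter on the indices is needed because a cluster point in a product need not be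
the limit of a subsequence.\<close>

lemma pointwise_cluster_point:
  fixes u :: "nat \<Rightarrow> 'a::real_normed_vector"
  assumes M: "\<And>n. norm (u n) \<le> M"
  obtains G :: "nat filter" and \<phi> :: "('a \<Rightarrow>\<^sub>L real) \<Rightarrow> real"
  where "G \<noteq> bot" "G \<le> sequentially" "\<And>f. ((\<lambda>n. blinfun_apply f (u n)) \<longlongrightarrow> \<phi> f) G"
proof -
  define E where "E n f = blinfun_apply f (u n)" for n and f :: "'a \<Rightarrow>\<^sub>L real"
  define K where "K = PiE (UNIV :: ('a \<Rightarrow>\<^sub>L real) set) (\<lambda>f. cball (0::real) (norm f * M))"
  have "compactin (product_topology (\<lambda>f. euclidean) UNIV) K"
    unfolding K_def by (subst compactin_PiE) simp
  then have "compact K"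
    by (simp add: euclidean_product_topology)
  moreover have "E n \<in> K" for n
  proof -
    have "\<bar>blinfun_apply f (u n)\<bar> \<le> norm f * M" for f :: "'a \<Rightarrow>\<^sub>L real"
      using norm_blinfun[of f "u n"] mult_left_mono[OF M[of n], of "norm f"] by simp
    then show ?thesis by (auto simp: K_def E_def PiE_iff dist_real_def)
  qed
  then have "eventually (\<lambda>y. y \<in> K) (filtermap E sequentially)"
    by (simp add: eventually_filtermap)
  moreover have "filtermap E sequentially \<noteq> bot"
    by (simp add: filtermap_bot_iff)
  ultimately obtain \<phi> where \<phi>: "inf (nhds \<phi>) (filtermap E sequentially) \<noteq> bot"
    unfolding compact_filter by blast
  define G where "G = inf sequentially (filtercomap E (nhds \<phi>))"
  have "G \<noteq> bot"
  proof
    assume "G = bot"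
    then obtain P Q where P: "eventually P sequentially" and Q: "eventually Q (nhds \<phi>)"
      and PQ: "\<And>n. P n \<Longrightarrow> Q (E n) \<Longrightarrow> False"
      unfolding G_def trivial_limit_def eventually_inf eventually_filtercomap by blast
    have "eventually (\<lambda>y. \<not> Q y) (filtermap E sequentially)"
      unfolding eventually_filtermap using P by eventually_elim (use PQ in blast)
    then have "eventually (\<lambda>y. False) (inf (nhds \<phi>) (filtermap E sequentially))"
      unfolding eventually_inf using Q by blast
    then show False
      using \<phi> by (simp add: trivial_limit_def)
  qed
  moreover have "G \<le> sequentially"
    by (simp add: G_def)
  moreover have "((\<lambda>n. blinfun_apply f (u n)) \<longlongrightarrow> \<phi> f) G" for f
  proof -
    have "(E \<longlongrightarrow> \<phi>) G"
      unfolding filterlim_iff_le_filtercomap G_def by simp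
    then have "((\<lambda>n. E n f) \<longlongrightarrow> \<phi> f) G"
      by (rule continuous_on_tendsto_compose[OF continuous_on_product_coordinates]) simp_all
    then show ?thesis by (simp add: E_def)
  qed
  ultimately show ?thesis by (rule that)
qed

text \<open>The reflexivity argument: with \<open>X f\<close> the minimizer of \<open>tilted f\<close> and \<open>c f = - tilted f (X f)\<close> the conjugate of
\<open>\<parallel>x\<parallel>\<^sup>2 / 2\<close>, Ekeland's principle applied to \<open>h = c - \<phi>\<close> shows that \<open>\<phi>\<close> is within any \<open>e > 0\<close>
of an evaluation at some \<open>X f\<close>.\<close>

lemma strong_minima_imp_weak_limit:
  fixes u :: "nat \<Rightarrow> 'a::banach" and \<phi> :: "('a \<Rightarrow>\<^sub>L real) \<Rightarrow> real"
  assumes strong: "\<And>f :: 'a \<Rightarrow>\<^sub>L real. attains_strong_minimum (tilted f)"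
    and M: "\<And>n. norm (u n) \<le> M"
    and G: "G \<noteq> bot" and \<phi>: "\<And>f. ((\<lambda>n. blinfun_apply f (u n)) \<longlongrightarrow> \<phi> f) G"
  shows "\<exists>v. \<forall>f. \<phi> f = blinfun_apply f v"
proof -
  have \<phi>_abs: "\<bar>\<phi> f\<bar> \<le> norm f * M" for f
  proof (rule tendsto_upperbound[OF _ _ G])
    show "((\<lambda>n. \<bar>blinfun_apply f (u n)\<bar>) \<longlongrightarrow> \<bar>\<phi> f\<bar>) G"
      by (intro tendsto_intros \<phi>)
    show "eventually (\<lambda>n. \<bar>blinfun_apply f (u n)\<bar> \<le> norm f * M) G"
      using norm_blinfun[of f] mult_left_mono[OF M, of "norm f"]
      by (intro always_eventually allI) (metis norm_ge_zero order_trans real_norm_def)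
  qed
  have "bounded_linear \<phi>"
  proof (rule bounded_linear_intro)
    show "\<phi> (f + g) = \<phi> f + \<phi> g" for f g
      using tendsto_unique[OF G \<phi>[of "f + g"]] tendsto_add[OF \<phi>[of f] \<phi>[of g]]
      by (simp add: plus_blinfun.rep_eq)
    show "\<phi> (c *\<^sub>R f) = c *\<^sub>R \<phi> f" for c f
      using tendsto_unique[OF G \<phi>[of "c *\<^sub>R f"]] tendsto_mult_left[OF \<phi>[of f], of c]
      by (simp add: scaleR_blinfun.rep_eq)
    show "norm (\<phi> f) \<le> norm f * M" for f
      using \<phi>_abs by simp
  qed
  then interpret \<phi>: bounded_linear \<phi> .
  define X where "X f = (SOME x. (\<forall>y. tilted f x \<le> tilted f y) \<and>
      (\<forall>s. (\<lambda>n. tilted f (s n)) \<longlonglongrightarrow> tilted f x \<longrightarrow> s \<longlonglongrightarrow> x))" for f :: "'a \<Rightarrow>\<^sub>L real"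
  have X_min: "(\<forall>y. tilted f (X f) \<le> tilted f y) \<and>
      (\<forall>s. (\<lambda>n. tilted f (s n)) \<longlonglongrightarrow> tilted f (X f) \<longrightarrow> s \<longlonglongrightarrow> X f)" for f
    unfolding X_def by (rule strong_minimumE[OF strong[of f]], rule someI_ex) blast
  have X: "tilted f (X f) \<le> tilted f y" for f y
    using X_min[of f] by simp
  have conv: "s \<longlonglongrightarrow> X f" if "(\<lambda>n. tilted f (s n)) \<longlonglongrightarrow> tilted f (X f)" for f s
    using X_min[of f] that by simp
  define h where "h f = - tilted f (X f) - \<phi> f" for f
  have approx: "\<exists>x. \<forall>g. \<bar>\<phi> g - blinfun_apply g x\<bar> \<le> e * norm g" if e: "0 < e" for e :: real
  proof -
    have "\<exists>f. \<forall>g. g \<noteq> f \<longrightarrow> h f < h g + e * dist f g"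
    proof (rule ekeland[OF e])
      fix f
      \<comment> \<open>Boundedness below: \<open>f (u n) - \<parallel>u n\<parallel>\<^sup>2 / 2 \<le> c f\<close> passes to the limit.\<close>
      have "\<phi> f \<le> 1 / 2 * M\<^sup>2 - tilted f (X f)"
      proof (rule tendsto_upperbound[OF \<phi> _ G])
        have "blinfun_apply f (u n) \<le> 1 / 2 * M\<^sup>2 - tilted f (X f)" for n
          using X[of f "u n"] power_mono[OF M norm_ge_zero, of n 2] by simp
        then show "eventually (\<lambda>n. blinfun_apply f (u n) \<le> 1 / 2 * M\<^sup>2 - tilted f (X f)) G"
          by simp
      qed
      then show "- (1 / 2 * M\<^sup>2) \<le> h f"
        by (simp add: h_def)
    next
      fix f b assume b: "b < h f"
      \<comment> \<open>Semicontinuity: \<open>h\<close> lies above this continuous function and touches it at \<open>f\<close>.\<close>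
      have "((\<lambda>g. - tilted g (X f) - \<phi> g) \<longlongrightarrow> - tilted f (X f) - \<phi> f) (nhds f)"
        by (intro tendsto_intros \<phi>.tendsto filterlim_ident)
      then have "eventually (\<lambda>g. b < - tilted g (X f) - \<phi> g) (nhds f)"
        using b by (intro order_tendstoD(1)) (auto simp: h_def)
      then show "eventually (\<lambda>g. b < h g) (nhds f)"
      proof eventually_elim
        case (elim g)
        then show ?case
          using X[of g "X f"] unfolding h_def by linarith
      qed
    qed
    then obtain f where f: "\<And>g. h f \<le> h g + e * dist f g"
      by (metis add.right_neutral dist_self less_imp_le mult_zero_right order_refl)
    \<comment> \<open>Moving from \<open>f\<close> to \<open>f + t g\<close> bounds \<open>\<phi> g\<close>, up to \<open>e \<parallel>g\<parallel>\<close>, by the value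
      of \<open>g\<close> at \<open>X (f + t g)\<close>. As
      \<open>t \<longrightarrow> 0\<close> these points become minimizing for \<open>tilted f\<close>, so they converge to \<open>X f\<close> because the
      minimum is strong.\<close>
    have one_sided: "\<phi> g \<le> blinfun_apply g (X f) + e * norm g" for g
    proof -
      define t where "t n = inverse (real (Suc n))" for n
      define z where "z n = X (f + t n *\<^sub>R g)" for n
      have t: "0 < t n" "t n \<le> 1" for n
        by (auto simp: t_def inverse_le_1_iff)
      have tilted_z: "tilted (f + t n *\<^sub>R g) y = tilted f y - t n * blinfun_apply g y" for n y
        by (simp add: plus_blinfun.rep_eq scaleR_blinfun.rep_eq)
      have gap: "tilted f (z n) - tilted f (X f)
          \<le> t n * (blinfun_apply g (z n) - \<phi> g + e * norm g)" for n
        using f[of "f + t n *\<^sub>R g"] t[of n] tilted_z[of "z n" n]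
        by (simp add: h_def z_def dist_norm \<phi>.add \<phi>.scaleR algebra_simps)
      have above: "\<phi> g \<le> blinfun_apply g (z n) + e * norm g" for n
      proof -
        have "0 \<le> t n * (blinfun_apply g (z n) - \<phi> g + e * norm g)"
          using gap[of n] X[of f "z n"] by linarith
        then show ?thesis
          using t[of n] by (simp add: zero_le_mult_iff)
      qed
      \<comment> \<open>The minimum of \<open>tilted (f + t g)\<close> is at most its value 0 at the origin.\<close>
      have z_le: "norm (z n) \<le> 2 * (norm f + norm g)" for n
      proof -
        have "(norm (z n))\<^sup>2 \<le> 2 * blinfun_apply (f + t n *\<^sub>R g) (z n)"
          using X[of "f + t n *\<^sub>R g" 0] by (simp add: z_def)
        also have "\<dots> \<le> 2 * (norm (f + t n *\<^sub>R g) * norm (z n))"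
          using norm_blinfun[of "f + t n *\<^sub>R g" "z n"] by simp
        finally have "norm (z n) * norm (z n) \<le> (2 * norm (f + t n *\<^sub>R g)) * norm (z n)"
          by (simp add: power2_eq_square)
        then have "norm (z n) \<le> 2 * norm (f + t n *\<^sub>R g)"
          by (cases "norm (z n) = 0") (auto dest: mult_right_le_imp_le)
        also have "norm (f + t n *\<^sub>R g) \<le> norm f + norm g"
          using norm_triangle_ineq[of f "t n *\<^sub>R g"] t[of n]
            mult_right_mono[of "t n" 1 "norm g"] by simp
        finally show ?thesis by simp
      qed
      define C where "C = norm g * (2 * (norm f + norm g)) - \<phi> g + e * norm g"
      have "blinfun_apply g (z n) - \<phi> g + e * norm g \<le> C" for n
        using norm_blinfun[of g "z n"] mult_left_mono[OF z_le[of n] norm_ge_zero[of g]]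
        by (simp add: C_def)
      then have gap_C: "tilted f (z n) - tilted f (X f) \<le> t n * C" for n
        using gap[of n] t[of n] by (meson less_imp_le mult_left_mono order_trans)
      have t0: "t \<longlonglongrightarrow> 0"
        unfolding t_def by (rule LIMSEQ_inverse_real_of_nat)
      have "norm (tilted f (z n) - tilted f (X f)) \<le> t n * C" for n
        using X[of f "z n"] gap_C[of n] unfolding real_norm_def by linarith
      then have "eventually (\<lambda>n. norm (tilted f (z n) - tilted f (X f)) \<le> t n * C) sequentially"
        by (intro always_eventually allI)
      then have "(\<lambda>n. tilted f (z n) - tilted f (X f)) \<longlonglongrightarrow> 0"
        using tendsto_mult_left_zero[OF t0] by (rule Lim_null_comparison)
      then have "z \<longlonglongrightarrow> X f"
        by (intro conv) (simp add: LIM_zero_iff)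
      then have "(\<lambda>n. blinfun_apply g (z n) + e * norm g) \<longlonglongrightarrow> blinfun_apply g (X f) + e * norm g"
        by (intro tendsto_intros)
      then show ?thesis
        using above by (intro LIMSEQ_le_const) auto
    qed
    \<comment> \<open>The other inequality is the same one for \<open>- g\<close>.\<close>
    have "\<bar>\<phi> g - blinfun_apply g (X f)\<bar> \<le> e * norm g" for g
      using one_sided[of g] one_sided[of "- g"]
      by (simp add: \<phi>.neg uminus_blinfun.rep_eq)
    then show ?thesis by blast
  qed
  then have "\<forall>n. \<exists>x. \<forall>g. \<bar>\<phi> g - blinfun_apply g x\<bar> \<le> inverse (real (Suc n)) * norm g"
    by simp
  then obtain x where x: "\<And>n g. \<bar>\<phi> g - blinfun_apply g (x n)\<bar> \<le> inverse (real (Suc n)) * norm g"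
    unfolding choice_iff by blast
  have dist_x: "dist (x m) (x n) \<le> inverse (real (Suc m)) + inverse (real (Suc n))" for m n
  proof -
    obtain g :: "'a \<Rightarrow>\<^sub>L real" where g: "\<And>y. \<bar>g y\<bar> \<le> norm y" "g (x m - x n) = norm (x m - x n)"
      using norming_functional[of "x m - x n"] by metis
    have "norm g \<le> 1"
      using g(1) by (intro norm_blinfun_bound) auto
    then have "inverse (real (Suc k)) * norm g \<le> inverse (real (Suc k))" for k
      using mult_left_mono[of "norm g" 1 "inverse (real (Suc k))"] by simp
    then show ?thesis
      using x[of g m] x[of g n] g(2) unfolding dist_norm
      by (smt (verit, best) blinfun.diff_right)
  qed
  have "Cauchy x"
  proof (rule metric_CauchyI)
    fix d :: real assume "0 < d"
    then obtain N where N: "inverse (real (Suc N)) < d / 2"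
      using reals_Archimedean[of "d / 2"] by auto
    have "inverse (real (Suc k)) \<le> inverse (real (Suc N))" if "N \<le> k" for k
      using that by (intro le_imp_inverse_le) auto
    then have "dist (x m) (x n) < d" if "N \<le> m" "N \<le> n" for m n
      using dist_x[of m n] N that by (smt (verit) field_sum_of_halves)
    then show "\<exists>N. \<forall>m\<ge>N. \<forall>n\<ge>N. dist (x m) (x n) < d" by blast
  qed
  then obtain v where v: "x \<longlonglongrightarrow> v"
    using Cauchy_convergent convergent_def by blast
  have "\<phi> g = blinfun_apply g v" for g
  proof -
    have "(\<lambda>n. inverse (real (Suc n)) * norm g) \<longlonglongrightarrow> 0"
      using tendsto_mult_left_zero[OF LIMSEQ_inverse_real_of_nat] .
    then have "(\<lambda>n. \<phi> g - blinfun_apply g (x n)) \<longlonglongrightarrow> 0"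
      by (rule Lim_null_comparison[rotated]) (use x in auto)
    moreover have "(\<lambda>n. \<phi> g - blinfun_apply g (x n)) \<longlonglongrightarrow> \<phi> g - blinfun_apply g v"
      by (intro tendsto_intros v)
    ultimately show ?thesis
      using LIMSEQ_unique by fastforce
  qed
  then show ?thesis by blast
qed

lemma weakly_closed_limit:
  fixes S :: "'a::real_normed_vector set"
  assumes S: "closedin weak_topology S" and G: "G \<noteq> bot"
    and lim: "\<And>f :: 'a \<Rightarrow>\<^sub>L real. ((\<lambda>n. blinfun_apply f (s n)) \<longlongrightarrow> blinfun_apply f v) G"
    and mem: "\<And>n. s n \<in> S"
  shows "v \<in> S"
proof (rule ccontr)
  assume "v \<notin> S"
  have nbhd: "v \<in> W \<longrightarrow> eventually (\<lambda>n. s n \<in> W) G"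
    if "generate_topology_on {blinfun_apply f -` U | (f :: 'a \<Rightarrow>\<^sub>L real) U. open U} W" for W
    using that
  proof induction
    case (Int a b)
    then show ?case by (auto intro: eventually_conj)
  next
    case (UN K)
    show ?case
    proof
      assume "v \<in> \<Union>K"
      then obtain k where "k \<in> K" "v \<in> k" by blast
      then have "eventually (\<lambda>n. s n \<in> k) G"
        using UN.IH by blast
      then show "eventually (\<lambda>n. s n \<in> \<Union>K) G"
        by eventually_elim (use \<open>k \<in> K\<close> in blast)
    qed
  next
    case (Basis W)
    then show ?case
      using lim by (auto simp: tendsto_def)
  qed simp
  have top: "v \<in> topspace weak_topology"
    by (auto simp: weak_topology_def)
  have "openin weak_topology (topspace weak_topology - S)"
    using S by (simp add: closedin_def)
  then have "eventually (\<lambda>n. s n \<in> topspace weak_topology - S) G"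
    using nbhd \<open>v \<notin> S\<close> top unfolding weak_topology_def openin_topology_generated_by_iff
    by blast
  then have "eventually (\<lambda>n. False) G"
    by eventually_elim (use mem in auto)
  then show False
    using G by (simp add: trivial_limit_def)
qed

text \<open>Sequences suffice to detect a limit along a filter in a metric space, in contrast to the weak topology.\<close>

lemma subsequence_along_filter:
  fixes a :: "nat \<Rightarrow> 'b::metric_space"
  assumes "G \<noteq> bot" "G \<le> sequentially" "(a \<longlongrightarrow> L) G"
  obtains r :: "nat \<Rightarrow> nat" where "strict_mono r" "(a \<circ> r) \<longlonglongrightarrow> L"
proof -
  have ex: "\<exists>n>N. dist (a n) L < inverse (real (Suc k))" for N k
  proof -
    have "eventually (\<lambda>n. n > N) G"
      using assms(2) eventually_gt_at_top[of N] by (rule filter_leD)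
    moreover have "eventually (\<lambda>n. dist (a n) L < inverse (real (Suc k))) G"
      using assms(3) by (intro tendstoD) auto
    ultimately show ?thesis
      using eventually_happens'[OF assms(1) eventually_conj] by blast
  qed
  have "\<exists>r. \<forall>k. dist (a (r k)) L < inverse (real (Suc k)) \<and> r k < r (Suc k)"
    by (rule dependent_nat_choice) (use ex in blast)+
  then obtain r where r: "\<And>k. dist (a (r k)) L < inverse (real (Suc k))" "\<And>k. r k < r (Suc k)"
    by blast
  have "eventually (\<lambda>k. norm (dist (a (r k)) L) \<le> inverse (real (Suc k))) sequentially"
    using r(1) by (intro always_eventually allI) (simp add: less_imp_le)
  then have "(\<lambda>k. dist (a (r k)) L) \<longlonglongrightarrow> 0"
    using LIMSEQ_inverse_real_of_nat by (rule Lim_null_comparison)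
  then have "(a \<circ> r) \<longlonglongrightarrow> L"
    unfolding o_def by (rule tendsto_dist_iff[THEN iffD2])
  then show ?thesis
    by (intro that[of r]) (simp_all add: strict_mono_Suc_iff r(2))
qed

section \<open>Strong minima give an E-space\<close>

lemma strong_minima_imp_rotund:
  assumes strong: "\<And>f :: 'a::real_normed_vector \<Rightarrow>\<^sub>L real. attains_strong_minimum (tilted f)"
  shows "rotund TYPE('a)"
  unfolding rotund_def
proof (intro allI impI)
  fix x y :: 'a
  assume xy: "norm x = 1 \<and> norm y = 1 \<and> x \<noteq> y"
  show "norm (midpoint x y) < 1"
  proof (rule ccontr)
    assume ge: "\<not> ?thesis"
    obtain f :: "'a \<Rightarrow>\<^sub>L real" where f: "\<And>z. \<bar>f z\<bar> \<le> norm z"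
      "f (midpoint x y) = norm (midpoint x y)"
      using norming_functional[of "midpoint x y"] by metis
    have "f x + f y \<ge> 2"
      using f(2) ge by (simp add: midpoint_def blinfun.add_right blinfun.scaleR_right)
    then have fxy: "f x = 1" "f y = 1"
      using f(1)[of x] f(1)[of y] xy by auto
    have "- (1 / 2) \<le> tilted f z" for z
    proof -
      have "0 \<le> (norm z - 1)\<^sup>2" by simp
      then show ?thesis
        using f(1)[of z] by (simp add: power2_diff)
    qed
    then have "(\<lambda>n::nat. y) \<longlonglongrightarrow> x"
      using xy fxy by (intro strong_minimum_at_minimizer[OF strong[of f]]) auto
    then show False
      using xy LIMSEQ_unique tendsto_const by blast
  qed
qed

text \<open>A weak limit \<open>v\<close> of the minimizing sequence has \<open>\<parallel>v - x\<parallel> = d\<close>; with \<open>f\<close> norming \<open>v - x\<close>, the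
strong minimum of \<open>tilted (d f)\<close> upgrades weak to norm convergence.\<close>

lemma strong_minima_imp_approximately_compact:
  fixes S :: "'a::banach set"
  assumes strong: "\<And>f :: 'a \<Rightarrow>\<^sub>L real. attains_strong_minimum (tilted f)"
    and S: "closedin weak_topology S"
  shows "approximately_compact S"
  unfolding approximately_compact_def
proof (intro allI impI, elim conjE)
  fix x and s :: "nat \<Rightarrow> 'a"
  define d where "d = (INF y\<in>S. norm (x - y))"
  assume mem: "\<forall>n. s n \<in> S" and "(\<lambda>n. norm (x - s n)) \<longlonglongrightarrow> (INF y\<in>S. norm (x - y))"
  then have d: "(\<lambda>n. norm (s n - x)) \<longlonglongrightarrow> d"
    by (simp add: d_def norm_minus_commute)
  obtain K where K: "\<And>n. norm (s n - x) \<le> K"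
    using convergent_imp_Bseq[of "\<lambda>n. norm (s n - x)"] d
    by (auto simp: convergent_def Bseq_def)
  have bounded: "norm (s n) \<le> K + norm x" for n
    using norm_triangle_sub[of "s n" x] K[of n] by linarith
  obtain G and \<phi> :: "('a \<Rightarrow>\<^sub>L real) \<Rightarrow> real"
    where G: "G \<noteq> bot" "G \<le> sequentially"
      and \<phi>: "\<And>f. ((\<lambda>n. blinfun_apply f (s n)) \<longlongrightarrow> \<phi> f) G"
    using that by (rule pointwise_cluster_point[of s, OF bounded])
  obtain v where "\<forall>f. \<phi> f = blinfun_apply f v"
    using strong_minima_imp_weak_limit[OF strong bounded G(1) \<phi>] by (elim exE) (rule that)
  then have v: "((\<lambda>n. f (s n)) \<longlongrightarrow> f v) G" for f :: "'a \<Rightarrow>\<^sub>L real"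
    using \<phi>[of f] by simp
  have "v \<in> S"
    using weakly_closed_limit[OF S G(1) v] mem by blast
  obtain f :: "'a \<Rightarrow>\<^sub>L real" where f: "\<And>z. \<bar>f z\<bar> \<le> norm z" "f (v - x) = norm (v - x)"
    using norming_functional[of "v - x"] by metis
  have dG: "((\<lambda>n. norm (s n - x)) \<longlongrightarrow> d) G"
    using d G(2) by (rule tendsto_mono[rotated])
  have fG: "((\<lambda>n. f (s n - x)) \<longlongrightarrow> f (v - x)) G"
    unfolding blinfun.diff_right by (intro tendsto_intros v)
  have norm_v: "norm (v - x) = d"
  proof (rule antisym)
    show "d \<le> norm (v - x)"
      unfolding d_def using \<open>v \<in> S\<close>
      by (subst norm_minus_commute, intro cINF_lower bdd_belowI2[where m = 0]) auto
    show "norm (v - x) \<le> d"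
      unfolding f(2)[symmetric]
      using f(1) by (intro tendsto_le[OF G(1) dG fG] always_eventually allI) (meson abs_le_D1)
  qed
  then have d0: "0 \<le> d"
    using norm_ge_zero[of "v - x"] by simp
  define g where "g = d *\<^sub>R f"
  have g: "g z = d * f z" for z
    by (simp add: g_def scaleR_blinfun.rep_eq)
  have minimal: "tilted g (v - x) \<le> tilted g z" for z
  proof -
    have "2 * (d * norm z) \<le> (norm z)\<^sup>2 + d\<^sup>2"
      using sum_squares_bound[of "norm z" d] by (simp add: mult_ac)
    moreover have "d * f z \<le> d * norm z"
      using f(1)[of z] d0 by (intro mult_left_mono) auto
    ultimately show ?thesis
      using f(2) norm_v by (simp add: g power2_eq_square)
  qed
  have "((\<lambda>n. tilted g (s n - x)) \<longlongrightarrow> tilted g (v - x)) G"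
    unfolding g norm_v by (intro tendsto_intros dG fG)
  then obtain r where r: "strict_mono r"
    "((\<lambda>n. tilted g (s n - x)) \<circ> r) \<longlonglongrightarrow> tilted g (v - x)"
    using subsequence_along_filter[OF G] by blast
  then have "(\<lambda>n. s (r n) - x) \<longlonglongrightarrow> v - x"
    by (intro strong_minimum_at_minimizer[OF strong minimal]) (simp add: o_def)
  then have "(\<lambda>n. s (r n) - x + x) \<longlonglongrightarrow> v - x + x"
    by (rule tendsto_add[OF _ tendsto_const])
  then have "(s \<circ> r) \<longlonglongrightarrow> v"
    unfolding o_def diff_add_cancel .
  then show "\<exists>l\<in>S. \<exists>r. strict_mono r \<and> (s \<circ> r) \<longlonglongrightarrow> l"
    using \<open>v \<in> S\<close> r(1) by (intro bexI[of _ v] exI[of _ r] conjI)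
qed

section \<open>E-spaces give strong minima\<close>

text \<open>Besides the lower bound, the square measures how far \<open>\<parallel>x\<parallel>\<close> is from \<open>\<parallel>f\<parallel>\<close> when \<open>x\<close> almost
attains it.\<close>

lemma tilted_ge:
  "- (1 / 2) * (norm f)\<^sup>2 + 1 / 2 * (norm x - norm f)\<^sup>2 \<le> tilted f x"
  using norm_blinfun[of f x] by (simp add: power2_diff algebra_simps)

lemma tilted_ge_min: "- (1 / 2) * (norm f)\<^sup>2 \<le> tilted f x"
  by (rule order_trans[OF _ tilted_ge]) simp

text \<open>Let \<open>m\<close> be the infimum. Evaluating \<open>tilted f\<close> on multiples of norm \<open>c\<close>, for any
\<open>c\<close> above \<open>sqrt (- 2 m)\<close>, shows that \<open>c\<close> is a bound for \<open>f\<close>; hence \<open>\<parallel>f\<parallel> \<le> sqrt (- 2 m)\<close>.\<close>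

lemma Inf_tilted:
  fixes f :: "'a::real_normed_vector \<Rightarrow>\<^sub>L real"
  shows "(INF x. tilted f x) = - (1 / 2) * (norm f)\<^sup>2"
proof (rule antisym)
  note lower = tilted_ge_min[of f]
  show "- (1 / 2) * (norm f)\<^sup>2 \<le> (INF x. tilted f x)"
    by (intro cINF_greatest) (use lower in auto)
  define m where "m = (INF x. tilted f x)"
  have m: "m \<le> tilted f x" for x
    unfolding m_def by (intro cINF_lower bdd_belowI2[OF lower]) auto
  have m0: "m \<le> 0"
    using m[of 0] by simp
  have "norm f \<le> sqrt (- 2 * m)"
  proof (rule dense_ge)
    fix c assume c: "sqrt (- 2 * m) < c"
    have c0: "0 < c"
      using c m0 by (smt (verit) real_sqrt_ge_zero)
    have "- 2 * m \<le> c\<^sup>2"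
      using c c0 by (meson less_imp_le real_sqrt_le_iff real_le_lsqrt sqrt_le_D)
    have bound: "f x \<le> c * norm x" for x
    proof (cases "x = 0")
      case False
      have "(c / norm x) * f x \<le> 1 / 2 * c\<^sup>2 - m"
        using m[of "(c / norm x) *\<^sub>R x"] False c0 by (simp add: blinfun.scaleR_right)
      also have "\<dots> \<le> c * c"
        using \<open>- 2 * m \<le> c\<^sup>2\<close> by (simp add: power2_eq_square)
      finally show ?thesis
        using False c0 by (simp add: field_simps)
    qed simp
    then have "\<bar>f x\<bar> \<le> c * norm x" for x
      using bound[of x] bound[of "- x"] by (simp add: blinfun.minus_right abs_le_iff)
    then show "norm f \<le> c"
      using c0 by (intro norm_blinfun_bound) auto
  qed
  then have "(norm f)\<^sup>2 \<le> - 2 * m"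
    using m0 power_mono[of "norm f" "sqrt (- 2 * m)" 2] by simp
  then show "(INF x. tilted f x) \<le> - (1 / 2) * (norm f)\<^sup>2"
    by (simp add: m_def)
qed

lemma minimizing_sequence:
  fixes f :: "'a::real_normed_vector \<Rightarrow>\<^sub>L real"
  obtains w where "(\<lambda>n::nat. tilted f (w n)) \<longlonglongrightarrow> - (1 / 2) * (norm f)\<^sup>2"
proof -
  have "bdd_below (range (tilted f))"
    by (rule bdd_belowI2[OF tilted_ge_min])
  then have "Inf (range (tilted f)) \<in> closure (range (tilted f))"
    by (intro closure_contains_Inf) auto
  then have "\<exists>a. (\<forall>n. a n \<in> range (tilted f)) \<and> a \<longlonglongrightarrow> - (1 / 2) * (norm f)\<^sup>2"
    unfolding closure_sequential Inf_tilted .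
  then obtain a where range: "\<And>n. a n \<in> range (tilted f)" and lim: "a \<longlonglongrightarrow> - (1 / 2) * (norm f)\<^sup>2"
    by auto
  define w where "w n = inv (tilted f) (a n)" for n
  have "tilted f (w n) = a n" for n
    unfolding w_def by (rule f_inv_into_f[OF range])
  then show ?thesis
    using that[of w] lim by simp
qed

lemma minimizing_sequence_norm:
  assumes s: "(\<lambda>n. tilted f (s n)) \<longlonglongrightarrow> - (1 / 2) * (norm f)\<^sup>2"
  shows "(\<lambda>n. norm (s n)) \<longlonglongrightarrow> norm f"
    and "(\<lambda>n. blinfun_apply f (s n)) \<longlonglongrightarrow> (norm f)\<^sup>2"
proof -
  have "(\<lambda>n. 2 * (tilted f (s n) + 1 / 2 * (norm f)\<^sup>2))
      \<longlonglongrightarrow> 2 * (- (1 / 2) * (norm f)\<^sup>2 + 1 / 2 * (norm f)\<^sup>2)"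
    by (intro tendsto_intros s)
  then have "(\<lambda>n. 2 * (tilted f (s n) + 1 / 2 * (norm f)\<^sup>2)) \<longlonglongrightarrow> 0"
    by simp
  then have "(\<lambda>n. (norm (s n) - norm f)\<^sup>2) \<longlonglongrightarrow> 0"
  proof (rule tendsto_sandwich[OF _ _ tendsto_const, rotated 2])
    have "(norm (s n) - norm f)\<^sup>2 \<le> 2 * (tilted f (s n) + 1 / 2 * (norm f)\<^sup>2)" for n
      using tilted_ge[of f "s n"] by simp
    then show "eventually (\<lambda>n. (norm (s n) - norm f)\<^sup>2
        \<le> 2 * (tilted f (s n) + 1 / 2 * (norm f)\<^sup>2)) sequentially"
      by simp
  qed simp
  then have "(\<lambda>n. norm (s n) - norm f) \<longlonglongrightarrow> 0"
    by (simp add: tendsto_null_power)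
  then show norm_lim: "(\<lambda>n. norm (s n)) \<longlonglongrightarrow> norm f"
    by (simp add: LIM_zero_iff)
  have "(\<lambda>n. 1 / 2 * (norm (s n))\<^sup>2 - tilted f (s n))
      \<longlonglongrightarrow> 1 / 2 * (norm f)\<^sup>2 - (- (1 / 2) * (norm f)\<^sup>2)"
    by (intro tendsto_intros norm_lim s)
  then show "(\<lambda>n. blinfun_apply f (s n)) \<longlonglongrightarrow> (norm f)\<^sup>2"
    by simp
qed

lemma weakly_closed_hyperplane:
  "closedin weak_topology {x. blinfun_apply f x = (c::real)}"
proof -
  have "topspace weak_topology = (UNIV :: 'a set)"
    by (auto simp: weak_topology_def)
  moreover have "openin weak_topology (blinfun_apply f -` (- {c}))"
    unfolding weak_topology_def by (intro topology_generated_by_Basis) auto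
  moreover have "blinfun_apply f -` (- {c}) = UNIV - {x. blinfun_apply f x = c}"
    by auto
  ultimately show ?thesis
    by (simp add: closedin_def)
qed

text \<open>The hyperplane \<open>f = \<parallel>f\<parallel>\<^sup>2\<close> has distance \<open>\<parallel>f\<parallel>\<close> from the origin, and the factors that move the
sequence onto it tend to 1.\<close>

lemma E_space_minimizing_subsequence:
  fixes f :: "'a::banach \<Rightarrow>\<^sub>L real"
  assumes E: "E_space TYPE('a)"
    and s: "(\<lambda>n. tilted f (s n)) \<longlonglongrightarrow> - (1 / 2) * (norm f)\<^sup>2"
  obtains l r where "strict_mono r" "(s \<circ> r) \<longlonglongrightarrow> l"
proof (cases "f = 0")
  case True
  then have "(\<lambda>n. norm (s n)) \<longlonglongrightarrow> 0"
    using minimizing_sequence_norm(1)[OF s] by simp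
  then have "(s \<circ> id) \<longlonglongrightarrow> 0"
    by (simp add: tendsto_norm_zero_iff)
  then show ?thesis
    by (rule that[of id, rotated]) (simp add: strict_mono_def)
next
  case False
  define N where "N = norm f"
  have N: "0 < N"
    using False by (simp add: N_def)
  note lims = minimizing_sequence_norm[OF s, folded N_def]
  define S where "S = {x. f x = N\<^sup>2}"
  have pos: "eventually (\<lambda>n. 0 < f (s n)) sequentially"
    by (rule order_tendstoD(1)[OF lims(2)]) (use N in simp)
  then obtain k where k: "0 < f (s k)"
    using eventually_happens' sequentially_bot by blast
  \<comment> \<open>The finitely many terms that no positive factor moves onto \<open>S\<close> are replaced by one that can
    be moved there.\<close>
  define q where "q n = (if 0 < f (s n) then s n else s k)" for n
  define t where "t n = (N\<^sup>2 / f (q n)) *\<^sub>R q n" for n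
  have q_pos: "0 < f (q n)" for n
    using k by (simp add: q_def)
  have tS: "t n \<in> S" for n
    using q_pos[of n] by (simp add: S_def t_def blinfun.scaleR_right)
  have q_eq: "eventually (\<lambda>n. q n = s n) sequentially"
    using pos by eventually_elim (simp add: q_def)
  have q_lims: "(\<lambda>n. norm (q n)) \<longlonglongrightarrow> N" "(\<lambda>n. f (q n)) \<longlonglongrightarrow> N\<^sup>2"
    using q_eq by (auto intro: Lim_transform_eventually[OF lims(1)] Lim_transform_eventually[OF lims(2)]
        elim!: eventually_mono)
  have "(\<lambda>n. N\<^sup>2 / f (q n) * norm (q n)) \<longlonglongrightarrow> N\<^sup>2 / N\<^sup>2 * N"
    by (intro tendsto_intros q_lims) (use N in auto)
  then have t_norm: "(\<lambda>n. norm (t n)) \<longlonglongrightarrow> N"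
    using N q_pos by (simp add: t_def less_imp_le abs_of_pos)
  have S_ge: "N \<le> norm y" if "y \<in> S" for y
  proof -
    have "N * N \<le> N * norm y"
      using norm_blinfun[of f y] that by (simp add: S_def N_def power2_eq_square)
    then show ?thesis using N by simp
  qed
  have "(INF y\<in>S. norm (0 - y)) = N"
  proof (rule antisym)
    show "N \<le> (INF y\<in>S. norm (0 - y))"
      using tS[of 0] S_ge by (intro cINF_greatest) auto
    have "(INF y\<in>S. norm (0 - y)) \<le> norm (0 - t n)" for n
      using tS by (intro cINF_lower bdd_belowI2[where m = 0]) auto
    then show "(INF y\<in>S. norm (0 - y)) \<le> N"
      using t_norm by (intro LIMSEQ_le_const[OF t_norm]) auto
  qed
  then have t_lim: "(\<forall>n. t n \<in> S) \<and> (\<lambda>n. norm (0 - t n)) \<longlonglongrightarrow> (INF y\<in>S. norm (0 - y))"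
    using tS t_norm by simp
  have "closedin weak_topology S" "S \<noteq> {}"
    using tS[of 0] unfolding S_def by (auto intro: weakly_closed_hyperplane)
  then have "approximately_compact S"
    using E by (simp add: E_space_def)
  then have "\<exists>l\<in>S. \<exists>r. strict_mono r \<and> (t \<circ> r) \<longlonglongrightarrow> l"
    using t_lim unfolding approximately_compact_def by (elim allE impE)
  then obtain l r where r: "strict_mono r" and l: "(t \<circ> r) \<longlonglongrightarrow> l"
    by (elim bexE exE conjE) (rule that)
  have "(\<lambda>n. (f (q (r n)) / N\<^sup>2) *\<^sub>R t (r n)) \<longlonglongrightarrow> (N\<^sup>2 / N\<^sup>2) *\<^sub>R l"
    using l LIMSEQ_subseq_LIMSEQ[OF q_lims(2) r] N
    by (intro tendsto_intros) (auto simp: o_def)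
  moreover have "(f (q n) / N\<^sup>2) *\<^sub>R t n = q n" for n
    using q_pos[of n] N by (simp add: t_def)
  ultimately have "(\<lambda>n. q (r n)) \<longlonglongrightarrow> l"
    using N by simp
  then have "(s \<circ> r) \<longlonglongrightarrow> l"
    using eventually_subseq[OF r q_eq] by (simp add: o_def Lim_transform_eventually)
  then show ?thesis
    using that r by blast
qed

text \<open>Minimizers have norm \<open>\<parallel>f\<parallel>\<close>, and \<open>f\<close> takes the value \<open>\<parallel>f\<parallel>\<^sup>2\<close> there. So \<open>f\<close> takes it at the
midpoint of two minimizers too, whose norm therefore cannot be smaller.\<close>

lemma rotund_minimizer_unique:
  fixes f :: "'a::real_normed_vector \<Rightarrow>\<^sub>L real"
  assumes rotund: "rotund TYPE('a)"
    and a: "tilted f a = - (1 / 2) * (norm f)\<^sup>2" and b: "tilted f b = - (1 / 2) * (norm f)\<^sup>2"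
  shows "a = b"
proof (rule ccontr)
  assume "a \<noteq> b"
  define N where "N = norm f"
  have norms: "norm a = N" "norm b = N"
    using tilted_ge[of f a] tilted_ge[of f b] a b by (simp_all add: N_def)
  then have N: "0 < N"
    using \<open>a \<noteq> b\<close> norm_ge_zero[of a] by (cases "N = 0") auto
  have vals: "f a = N\<^sup>2" "f b = N\<^sup>2"
    using a b norms by (simp_all add: N_def)
  have "norm (midpoint (a /\<^sub>R N) (b /\<^sub>R N)) < 1"
    using rotund norms N \<open>a \<noteq> b\<close> by (auto simp: rotund_def)
  moreover have "f (midpoint (a /\<^sub>R N) (b /\<^sub>R N)) = N"
    using vals N by (simp add: midpoint_def blinfun.add_right blinfun.scaleR_right power2_eq_square)
  moreover have "f (midpoint (a /\<^sub>R N) (b /\<^sub>R N)) \<le> N * norm (midpoint (a /\<^sub>R N) (b /\<^sub>R N))"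
    using norm_blinfun[of f "midpoint (a /\<^sub>R N) (b /\<^sub>R N)"] by (simp add: N_def)
  ultimately show False
    using N by simp
qed

lemma E_space_imp_strong_minimum:
  fixes f :: "'a::banach \<Rightarrow>\<^sub>L real"
  assumes E: "E_space TYPE('a)"
  shows "attains_strong_minimum (tilted f)"
proof -
  define m where "m = - (1 / 2) * (norm f)\<^sup>2"
  have limit: "tilted f l = m" if "(\<lambda>n. tilted f (s n)) \<longlonglongrightarrow> m" "s \<longlonglongrightarrow> l" for s l
  proof -
    have "(\<lambda>n. tilted f (s n)) \<longlonglongrightarrow> tilted f l"
      by (intro tendsto_intros that)
    then show ?thesis
      using that(1) LIMSEQ_unique by blast
  qed
  have sub: "\<exists>l r. strict_mono r \<and> (s \<circ> r) \<longlonglongrightarrow> l \<and> tilted f l = m"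
    if s: "(\<lambda>n. tilted f (s n)) \<longlonglongrightarrow> m" for s
  proof -
    obtain l r where r: "strict_mono r" and l: "(s \<circ> r) \<longlonglongrightarrow> l"
      using E_space_minimizing_subsequence[OF E s[unfolded m_def]] .
    then show ?thesis
      using limit[OF _ l] LIMSEQ_subseq_LIMSEQ[OF s r] by (auto simp: o_def)
  qed
  obtain w where w: "(\<lambda>n. tilted f (w n)) \<longlonglongrightarrow> m"
    unfolding m_def by (rule minimizing_sequence)
  obtain x where x: "tilted f x = m"
    using sub[OF w] by (elim exE conjE) (rule that)
  have "tilted f x \<le> tilted f y" for y
    unfolding x m_def by (rule tilted_ge_min)
  moreover have "s \<longlonglongrightarrow> x" if s: "(\<lambda>n. tilted f (s n)) \<longlonglongrightarrow> m" for s
  proof (rule ccontr)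
    assume "\<not> s \<longlonglongrightarrow> x"
    then obtain e where e: "0 < e" "\<not> eventually (\<lambda>n. dist (s n) x < e) sequentially"
      by (auto simp: tendsto_iff)
    then obtain r :: "nat \<Rightarrow> nat" where r: "strict_mono r" and far: "\<And>n. \<not> dist (s (r n)) x < e"
      using not_eventually_sequentiallyD[OF e(2)] by blast
    have "(\<lambda>n. tilted f ((s \<circ> r) n)) \<longlonglongrightarrow> m"
      using LIMSEQ_subseq_LIMSEQ[OF s r] by (simp add: o_def)
    then obtain l r' where l: "((s \<circ> r) \<circ> r') \<longlonglongrightarrow> l" and "tilted f l = m"
      using sub by blast
    then have "l = x"
      using rotund_minimizer_unique[where f = f and a = l and b = x] E x by (simp add: E_space_def m_def)
    then have "eventually (\<lambda>n. dist (s (r (r' n))) x < e) sequentially"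
      using tendstoD[OF l e(1)] by (simp add: o_def)
    then show False
      using far by simp
  qed
  ultimately show ?thesis
    unfolding attains_strong_minimum_def Inf_tilted m_def[symmetric] by blast
qed

theorem proposition8:
  shows "(\<forall>f :: 'a::banach \<Rightarrow>\<^sub>L real.
            attains_strong_minimum (\<lambda>x. 1 / 2 * (norm x)\<^sup>2 - blinfun_apply f x))
         \<longleftrightarrow> E_space TYPE('a)"
proof
  assume "\<forall>f :: 'a \<Rightarrow>\<^sub>L real. attains_strong_minimum (tilted f)"
  then show "E_space TYPE('a)"
    unfolding E_space_def
    using strong_minima_imp_rotund strong_minima_imp_approximately_compact by blast
next
  assume "E_space TYPE('a)"
  then show "\<forall>f :: 'a \<Rightarrow>\<^sub>L real. attains_strong_minimum (tilted f)"
    using E_space_imp_strong_minimum by blast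
qed

end
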